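(* Let $p$ be a probability distribution on $\mathbb{R}^D$, let $x\in\mathbb{R}^D$ be fixed, let $n\ge1$, and let $y,y_1,\dots,y_n$ be i.i.d. with distribution $p$. Let $w=k(x,y)$, and assume that for some constants $M,C>0$ one has $w\in[0,M]$ and $\|y\|\le C$ almost surely, that $\Pr(w>0)=1$, and that $\mathbb{E}[w]>0$. Then, almost surely, the analytically bias-corrected (ABC) centroid $T_n^{\mathrm{ABC}}$ of $y_1,\dots,y_n$ satisfies $$T_n^{\mathrm{ABC}}=\sum_{i=1}^n\gamma_i\,y_i,\qquad \gamma_i=\alpha_i\Bigl(1-\sum_{j=1}^n\alpha_j^2\Bigr)+\alpha_i^2\ge 0,\qquad \sum_{i=1}^n\gamma_i=1.$$ Hence $T_n^{\mathrm{ABC}}$ lies in the convex hull of $\{y_1,\dots,y_n\}$.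
   Context: $k:\mathbb{R}^D\times\mathbb{R}^D\to\mathbb{R}$ is a kernel (with $k(x,\cdot)$ measurable), and $\|\cdot\|$ is the Euclidean norm. With $w_i=k(x,y_i)$ and $\alpha_i=w_i/\sum_{j=1}^n w_j$ (well defined on the event $\sum_{j=1}^n w_j>0$, which has probability one under the hypotheses), the minibatch centroid is $T_n:=\sum_{i=1}^n\alpha_i y_i$, the plug-in correction is $\Delta_n:=\sum_{i=1}^n\alpha_i^2\,(T_n-y_i)$, and the ABC centroid is $T_n^{\mathrm{ABC}}:=T_n-\Delta_n$. *)

theory Defs
  imports "HOL-Probability.Probability"
begin

text \<open>
  A minibatch is a sequence \<open>y :: nat \<Rightarrow> real ^ 'd\<close> of which only the entries
  \<open>y 1, \<dots>, y n\<close> are used. The quantities below have their intended meaning when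
  \<open>(\<Sum>j=1..n. k x (y j)) > 0\<close>; otherwise HOL's convention for division by zero may apply.
\<close>

definition centroid_weight ::
  "(real ^ 'd \<Rightarrow> real ^ 'd \<Rightarrow> real) \<Rightarrow> real ^ 'd \<Rightarrow> nat \<Rightarrow> (nat \<Rightarrow> real ^ 'd) \<Rightarrow> nat \<Rightarrow> real"
  where "centroid_weight k x n y i = k x (y i) / (\<Sum>j=1..n. k x (y j))"

definition minibatch_centroid ::
  "(real ^ 'd \<Rightarrow> real ^ 'd \<Rightarrow> real) \<Rightarrow> real ^ 'd \<Rightarrow> nat \<Rightarrow> (nat \<Rightarrow> real ^ 'd) \<Rightarrow> real ^ 'd"
  where "minibatch_centroid k x n y = (\<Sum>i=1..n. centroid_weight k x n y i *\<^sub>R y i)"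

definition plugin_correction ::
  "(real ^ 'd \<Rightarrow> real ^ 'd \<Rightarrow> real) \<Rightarrow> real ^ 'd \<Rightarrow> nat \<Rightarrow> (nat \<Rightarrow> real ^ 'd) \<Rightarrow> real ^ 'd"
  where "plugin_correction k x n y =
    (\<Sum>i=1..n. (centroid_weight k x n y i)\<^sup>2 *\<^sub>R (minibatch_centroid k x n y - y i))"

definition abc_centroid ::
  "(real ^ 'd \<Rightarrow> real ^ 'd \<Rightarrow> real) \<Rightarrow> real ^ 'd \<Rightarrow> nat \<Rightarrow> (nat \<Rightarrow> real ^ 'd) \<Rightarrow> real ^ 'd"
  where "abc_centroid k x n y = minibatch_centroid k x n y - plugin_correction k x n y"

definition abc_weight ::
  "(real ^ 'd \<Rightarrow> real ^ 'd \<Rightarrow> real) \<Rightarrow> real ^ 'd \<Rightarrow> nat \<Rightarrow> (nat \<Rightarrow> real ^ 'd) \<Rightarrow> nat \<Rightarrow> real"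
  where "abc_weight k x n y i =
    centroid_weight k x n y i * (1 - (\<Sum>j=1..n. (centroid_weight k x n y j)\<^sup>2))
      + (centroid_weight k x n y i)\<^sup>2"

end

theory Submission
  imports Defs
begin

text \<open>
  Expanding the correction gives \<open>T - \<Delta> = (1 - S) T + \<Sum> \<alpha>\<^sub>i\<^sup>2 y\<^sub>i\<close> with \<open>S = \<Sum> \<alpha>\<^sub>j\<^sup>2\<close>, whose
  coefficients are the \<open>\<gamma>\<^sub>i\<close> and add up to \<open>(1 - S) + S = 1\<close>. They are nonnegative because
  \<open>0 \<le> \<alpha>\<^sub>j \<le> 1\<close> forces \<open>S \<le> \<Sum> \<alpha>\<^sub>j = 1\<close>. Almost surely all the kernel weights are positive, since
  each \<open>y\<^sub>i\<close> has the distribution of \<open>y\<close>.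
\<close>

lemma sum_centroid_weight:
  assumes "(\<Sum>j=1..n. k x (y j)) \<noteq> 0"
  shows "(\<Sum>i=1..n. centroid_weight k x n y i) = 1"
  using assms by (simp add: centroid_weight_def flip: sum_divide_distrib)

text \<open>The expansion uses linearity alone, so it also covers a vanishing total weight: there
  division by zero makes every \<open>centroid_weight\<close> 0 and both sides vanish.\<close>

lemma abc_centroid_eq_sum:
  "abc_centroid k x n y = (\<Sum>i=1..n. abc_weight k x n y i *\<^sub>R y i)"
proof -
  let ?a = "centroid_weight k x n y"
  let ?T = "minibatch_centroid k x n y"
  let ?S = "\<Sum>j=1..n. (?a j)\<^sup>2"
  have "plugin_correction k x n y = ?S *\<^sub>R ?T - (\<Sum>i=1..n. (?a i)\<^sup>2 *\<^sub>R y i)"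
    by (simp add: plugin_correction_def scaleR_right_diff_distrib sum_subtractf scaleR_sum_left)
  then have "abc_centroid k x n y = (1 - ?S) *\<^sub>R ?T + (\<Sum>i=1..n. (?a i)\<^sup>2 *\<^sub>R y i)"
    by (simp add: abc_centroid_def scaleR_left_diff_distrib)
  also have "(1 - ?S) *\<^sub>R ?T = (\<Sum>i=1..n. (?a i * (1 - ?S)) *\<^sub>R y i)"
    by (simp add: minibatch_centroid_def scaleR_sum_right mult.commute)
  finally show ?thesis
    by (simp add: abc_weight_def scaleR_left_distrib sum.distrib)
qed

lemma sum_abc_weight:
  assumes "(\<Sum>j=1..n. k x (y j)) \<noteq> 0"
  shows "(\<Sum>i=1..n. abc_weight k x n y i) = 1"
  using sum_centroid_weight[of k x y n] assms
  by (simp add: abc_weight_def sum.distrib flip: sum_distrib_right)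

lemma abc_weight_nonneg:
  assumes nonneg: "\<And>j. j \<in> {1..n} \<Longrightarrow> k x (y j) \<ge> 0"
    and pos: "(\<Sum>j=1..n. k x (y j)) > 0"
    and i: "i \<in> {1..n}"
  shows "abc_weight k x n y i \<ge> 0"
proof -
  let ?a = "centroid_weight k x n y"
  have a_nonneg: "?a j \<ge> 0" if "j \<in> {1..n}" for j
    using nonneg[OF that] pos by (simp add: centroid_weight_def)
  have sum_a: "(\<Sum>j=1..n. ?a j) = 1"
    using pos by (intro sum_centroid_weight) simp
  \<comment> \<open>A single term of a nonnegative sum is at most the total, here 1.\<close>
  have a_le_1: "?a j \<le> 1" if "j \<in> {1..n}" for j
    using member_le_sum[OF that, of ?a] a_nonneg sum_a by simp
  have "(\<Sum>j=1..n. (?a j)\<^sup>2) \<le> (\<Sum>j=1..n. ?a j)"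
    using a_nonneg a_le_1 by (intro sum_mono) (simp add: power2_eq_square mult_left_le)
  then show ?thesis
    using a_nonneg[OF i] sum_a by (simp add: abc_weight_def)
qed

text \<open>The hull is convex and contains every \<open>y i\<close>. The convex combination is
  indexed by \<open>i\<close> rather than by points, so repeated sample points cause no
  trouble.\<close>

lemma abc_centroid_in_convex_hull:
  assumes "\<And>j. j \<in> {1..n} \<Longrightarrow> k x (y j) \<ge> 0"
    and "(\<Sum>j=1..n. k x (y j)) > 0"
  shows "abc_centroid k x n y \<in> convex hull (y ` {1..n})"
  unfolding abc_centroid_eq_sum
proof (rule convex_sum)
  show "(\<Sum>i=1..n. abc_weight k x n y i) = 1"
    using assms(2) by (intro sum_abc_weight) simp
  show "abc_weight k x n y i \<ge> 0" if "i \<in> {1..n}" for i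
    using assms that by (rule abc_weight_nonneg)
qed (auto intro: hull_inc)

text \<open>Both sides say that \<open>Q\<close> holds almost everywhere under the common law. This
  carries positivity of the kernel weight from \<open>y\<close> to each \<open>Y i\<close>.\<close>

lemma AE_eq_distr:
  assumes "X \<in> measurable P N" "Y \<in> measurable P N"
    and "distr P N X = distr P N Y"
    and "{z \<in> space N. Q z} \<in> sets N"
  shows "(AE \<omega> in P. Q (X \<omega>)) \<longleftrightarrow> (AE \<omega> in P. Q (Y \<omega>))"
  using AE_distr_iff[OF assms(1,4)] AE_distr_iff[OF assms(2,4)] assms(3) by metis

theorem proposition4p2:
  fixes P :: "'a measure"
    and p :: "(real ^ 'd) measure"
    and k :: "real ^ 'd \<Rightarrow> real ^ 'd \<Rightarrow> real"
    and x :: "real ^ 'd"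
    and n :: nat
    and y :: "'a \<Rightarrow> real ^ 'd"
    and Y :: "nat \<Rightarrow> 'a \<Rightarrow> real ^ 'd"
    and M C :: real
  assumes "prob_space P"
    and "prob_space p" and "sets p = sets borel"
    and "k x \<in> borel_measurable borel"
    and "n \<ge> 1"
    and "prob_space.indep_vars P (\<lambda>_. borel) (Y(0 := y)) {0..n}"
    and "distr P borel y = p"
    and "\<And>i. i \<in> {1..n} \<Longrightarrow> distr P borel (Y i) = p"
    and "M > 0" and "C > 0"
    and "AE \<omega> in P. k x (y \<omega>) \<in> {0..M}"
    and "AE \<omega> in P. norm (y \<omega>) \<le> C"
    and "measure P {\<omega> \<in> space P. k x (y \<omega>) > 0} = 1"
    and "prob_space.expectation P (\<lambda>\<omega>. k x (y \<omega>)) > 0"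
  shows "AE \<omega> in P.
    (\<Sum>j=1..n. k x (Y j \<omega>)) > 0 \<and>
    abc_centroid k x n (\<lambda>i. Y i \<omega>) =
      (\<Sum>i=1..n. abc_weight k x n (\<lambda>i. Y i \<omega>) i *\<^sub>R Y i \<omega>) \<and>
    (\<forall>i\<in>{1..n}. abc_weight k x n (\<lambda>i. Y i \<omega>) i \<ge> 0) \<and>
    (\<Sum>i=1..n. abc_weight k x n (\<lambda>i. Y i \<omega>) i) = 1 \<and>
    abc_centroid k x n (\<lambda>i. Y i \<omega>) \<in> convex hull ((\<lambda>i. Y i \<omega>) ` {1..n})"
proof -
  interpret prob_space P by fact
  \<comment> \<open>The independent family stores \<open>y\<close> at index 0 and the sample at 1 to
    \<open>n\<close>; its definition includes measurability of each member.\<close>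
  have rv: "random_variable borel ((Y(0 := y)) i)" if "i \<in> {0..n}" for i
    using assms(6) that by (auto simp: indep_vars_def)
  have y: "random_variable borel y"
    using rv[of 0] by simp
  have Y: "random_variable borel (Y i)" if "i \<in> {1..n}" for i
    using rv[of i] that by simp
  have "(\<lambda>\<omega>. k x (y \<omega>)) \<in> borel_measurable P"
    using y assms(4) by (rule measurable_compose)
  then have ev: "{\<omega> \<in> space P. k x (y \<omega>) > 0} \<in> events"
    by measurable
  have pos_set: "{z \<in> space borel. k x z > 0} \<in> sets borel"
    using assms(4) by measurable
  have "AE \<omega> in P. k x (y \<omega>) > 0"
    using assms(13) prob_Collect_eq_1[OF ev] by simp
  then have "AE \<omega> in P. k x (Y i \<omega>) > 0" if "i \<in> {1..n}" for i
    using AE_eq_distr[OF y Y[OF that] _ pos_set] assms(7) assms(8)[OF that] by simp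
  \<comment> \<open>A finite union of null sets is null; from here on the argument is pointwise in
    \<omega>.\<close>
  then have "AE \<omega> in P. \<forall>i\<in>{1..n}. k x (Y i \<omega>) > 0"
    by (intro AE_finite_allI) auto
  then show ?thesis
  proof eventually_elim
    case (elim \<omega>)
    then have nonneg: "\<And>j. j \<in> {1..n} \<Longrightarrow> k x (Y j \<omega>) \<ge> 0"
      by (simp add: less_imp_le)
    \<comment> \<open>Strict positivity of the sum uses that \<open>{1..n}\<close> is nonempty, that
      is, \<open>n \<ge> 1\<close>.\<close>
    have pos: "(\<Sum>j=1..n. k x (Y j \<omega>)) > 0"
      using elim assms(5) by (intro sum_pos) auto
    show ?case
      using pos abc_centroid_eq_sum sum_abc_weight[of k x "\<lambda>i. Y i \<omega>" n]
        abc_weight_nonneg[of n k x "\<lambda>i. Y i \<omega>", OF nonneg pos]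
        abc_centroid_in_convex_hull[of n k x "\<lambda>i. Y i \<omega>", OF nonneg pos]
      by auto
  qed
qed

end
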